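(* Let $\mathbf{M}=(M_p)_{p\in\mathbb{N}_0}$ and $\mathbf{N}=(N_p)_{p\in\mathbb{N}_0}$ be sequences of positive real numbers with $M_0=N_0=1$ and consider the following assertions: (i) $\mathbf{M}\preceq\mathbf{N}$; (ii) $\mathcal{S}_{\{\mathbf{M}\}}(\mathbb{R}^d)\subseteq\mathcal{S}_{\{\mathbf{N}\}}(\mathbb{R}^d)$ is valid with continuous inclusion. Then (i)$\Rightarrow$(ii) is valid for all dimensions $d\in\mathbb{N}$, and the classes in (ii) can be defined by joint or separated growth at infinity. If $\mathbf{M}\in\mathcal{LC}$ is non-quasianalytic, i.e. $\sum_{k\ge 1}\frac{M_{k-1}}{M_k}<\infty$, and if (ii) holds for the case $d=1$, then (ii)$\Rightarrow$(i) is valid, too.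
   Context: $\mathbb{N}_0=\mathbb{N}\cup\{0\}$. $\mathcal{LC}$ is the set of positive sequences $\mathbf{M}=(M_p)_{p\in\mathbb{N}_0}$ with $M_1\ge M_0=1$, $M_p^2\le M_{p-1}M_{p+1}$ for $p\ge 1$, and $\lim_{p\to\infty}(M_p)^{1/p}=\infty$. $\mathbf{M}\preceq\mathbf{N}$ means: there is $C\ge 1$ with $M_p\le C^pN_p$ for all $p\in\mathbb{N}_0$. For $d\in\mathbb{N}$ a sequence $(M_p)_{p\in\mathbb{N}_0}$ is extended to multi-indices by $M_\alpha:=M_{|\alpha|}$, $\alpha\in\mathbb{N}_0^d$. $\mathcal{S}_{\{\mathbf{M}\}}(\mathbb{R}^d)$ is the space of all $f\in C^\infty(\mathbb{R}^d)$ with $\sup_{\alpha,\beta\in\mathbb{N}_0^d}\frac{\|x^\alpha\partial^\beta f\|_\infty}{h^{|\alpha+\beta|}M_{\alpha+\beta}}<\infty$ for some $h>0$, with the inductive limit topology over $h$ ($\|\cdot\|_\infty$ is the supremum norm on $\mathbb{R}^d$). This is the definition by joint growth at infinity; in the definition by separated growth at infinity, $M_{\alpha+\beta}$ is replaced by $M_\alpha M_\beta$. *)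

theory Defs
  imports "HOL-Analysis.Analysis"
begin

section \<open>Weight sequences\<close>

definition LC :: "(nat \<Rightarrow> real) set" where
  "LC = {M. (\<forall>p. M p > 0) \<and> M 0 = 1 \<and> M 1 \<ge> M 0 \<and>
            (\<forall>p\<ge>1. (M p)\<^sup>2 \<le> M (p - 1) * M (p + 1)) \<and>
            filterlim (\<lambda>p. M p powr (1 / real p)) at_top sequentially}"

definition preceq :: "(nat \<Rightarrow> real) \<Rightarrow> (nat \<Rightarrow> real) \<Rightarrow> bool"  (infix "\<preceq>" 50) where
  "M \<preceq> N \<longleftrightarrow> (\<exists>C\<ge>1. \<forall>p. M p \<le> C ^ p * N p)"

definition non_quasianalytic :: "(nat \<Rightarrow> real) \<Rightarrow> bool" where
  "non_quasianalytic M \<longleftrightarrow> summable (\<lambda>k. M k / M (Suc k))"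


section \<open>Multi-indices and partial derivatives\<close>

text \<open>Multi-indices of length \<open>d = CARD('n)\<close> are elements of \<open>nat ^ 'n\<close>.\<close>

definition mi_abs :: "nat ^ 'n::finite \<Rightarrow> nat" where
  "mi_abs \<alpha> = (\<Sum>i\<in>UNIV. \<alpha> $ i)"

definition mi_monom :: "nat ^ 'n::finite \<Rightarrow> real ^ 'n \<Rightarrow> real" where
  "mi_monom \<alpha> x = (\<Prod>i\<in>UNIV. (x $ i) ^ (\<alpha> $ i))"

definition has_partial :: "'n::finite \<Rightarrow> (real ^ 'n \<Rightarrow> complex) \<Rightarrow> bool" where
  "has_partial i f \<longleftrightarrow> (\<forall>x. (\<lambda>t::real. f (x + t *\<^sub>R axis i 1)) differentiable (at 0))"

definition partial :: "'n::finite \<Rightarrow> (real ^ 'n \<Rightarrow> complex) \<Rightarrow> real ^ 'n \<Rightarrow> complex" where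
  "partial i f x = vector_derivative (\<lambda>t::real. f (x + t *\<^sub>R axis i 1)) (at 0)"

definition partials :: "'n::finite list \<Rightarrow> (real ^ 'n \<Rightarrow> complex) \<Rightarrow> real ^ 'n \<Rightarrow> complex" where
  "partials is f = foldr partial is f"

text \<open>\<open>C\<^sup>\<infinity>\<close>: all iterated partial derivatives, in every order, exist and are continuous.\<close>

definition smooth :: "(real ^ 'n::finite \<Rightarrow> complex) \<Rightarrow> bool" where
  "smooth f \<longleftrightarrow>
     (\<forall>is. continuous_on UNIV (partials is f) \<and> (\<forall>i. has_partial i (partials is f)))"

text \<open>The index type carries no order, so some enumeration of the \<open>|\<beta>|\<close> differentiations is
  chosen; by the symmetry of mixed partial derivatives the choice is irrelevant for the smooth
  functions to which the operator is applied.\<close>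

definition mi_partial :: "nat ^ 'n::finite \<Rightarrow> (real ^ 'n \<Rightarrow> complex) \<Rightarrow> real ^ 'n \<Rightarrow> complex" where
  "mi_partial \<beta> f = partials (SOME is. \<forall>i. count_list is i = \<beta> $ i) f"


section \<open>Inductive limits of locally convex topologies on spaces of functions\<close>

text \<open>Linear structure on function spaces is pointwise; scalars are complex. Hausdorffness is not
  required, which is harmless for taking the finest topology below.\<close>

definition lc_topology :: "('a \<Rightarrow> complex) topology \<Rightarrow> bool" where
  "lc_topology T \<longleftrightarrow>
     continuous_map (prod_topology T T) T (\<lambda>(f, g). \<lambda>x. f x + g x) \<and>
     continuous_map (prod_topology euclidean T) T (\<lambda>(c, f). \<lambda>x. c * f x) \<and>
     (\<forall>U. openin T U \<and> (\<lambda>x. 0) \<in> U \<longrightarrow>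
        (\<exists>V. openin T V \<and> (\<lambda>x. 0) \<in> V \<and> V \<subseteq> U \<and>
             (\<forall>f\<in>V. \<forall>g\<in>V. \<forall>t\<in>{0..1}.
                (\<lambda>x. complex_of_real (1 - t) * f x + complex_of_real t * g x) \<in> V)))"

definition lc_admissible ::
    "'i set \<Rightarrow> ('i \<Rightarrow> ('a \<Rightarrow> complex) topology) \<Rightarrow> ('a \<Rightarrow> complex) topology \<Rightarrow> bool" where
  "lc_admissible I E T \<longleftrightarrow>
     lc_topology T \<and> topspace T = (\<Union>i\<in>I. topspace (E i)) \<and>
     (\<forall>i\<in>I. continuous_map (E i) T (\<lambda>f. f))"

text \<open>The finest locally convex topology on the union of the steps for which all inclusions of the
  steps are continuous: the supremum of all admissible topologies.\<close>

definition ind_limit ::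
    "'i set \<Rightarrow> ('i \<Rightarrow> ('a \<Rightarrow> complex) topology) \<Rightarrow> ('a \<Rightarrow> complex) topology" where
  "ind_limit I E = topology_generated_by {U. \<exists>T. lc_admissible I E T \<and> openin T U}"


section \<open>Gelfand--Shilov classes\<close>

datatype growth = Joint | Separated

fun gs_weight :: "growth \<Rightarrow> (nat \<Rightarrow> real) \<Rightarrow> nat ^ 'n::finite \<Rightarrow> nat ^ 'n \<Rightarrow> real" where
  "gs_weight Joint M \<alpha> \<beta> = M (mi_abs (\<alpha> + \<beta>))"
| "gs_weight Separated M \<alpha> \<beta> = M (mi_abs \<alpha>) * M (mi_abs \<beta>)"

definition sup_norm :: "('a \<Rightarrow> complex) \<Rightarrow> ennreal" where
  "sup_norm f = (SUP x. ennreal (norm (f x)))"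

definition gs_norm ::
    "growth \<Rightarrow> (nat \<Rightarrow> real) \<Rightarrow> real \<Rightarrow> (real ^ 'n::finite \<Rightarrow> complex) \<Rightarrow> ennreal" where
  "gs_norm s M h f =
     (SUP (\<alpha>, \<beta>). sup_norm (\<lambda>x. complex_of_real (mi_monom \<alpha> x) * mi_partial \<beta> f x)
                  / ennreal (h ^ mi_abs (\<alpha> + \<beta>) * gs_weight s M \<alpha> \<beta>))"

definition gs_class :: "growth \<Rightarrow> (nat \<Rightarrow> real) \<Rightarrow> (real ^ 'n::finite \<Rightarrow> complex) set" where
  "gs_class s M = {f. smooth f \<and> (\<exists>h>0. gs_norm s M h f < \<infinity>)}"

definition gs_step :: "growth \<Rightarrow> (nat \<Rightarrow> real) \<Rightarrow> real \<Rightarrow> (real ^ 'n::finite \<Rightarrow> complex) set" where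
  "gs_step s M h = {f. smooth f \<and> gs_norm s M h f < \<infinity>}"

definition gs_step_topology ::
    "growth \<Rightarrow> (nat \<Rightarrow> real) \<Rightarrow> real \<Rightarrow> (real ^ 'n::finite \<Rightarrow> complex) topology" where
  "gs_step_topology s M h = topology (\<lambda>U. U \<subseteq> gs_step s M h \<and>
     (\<forall>f\<in>U. \<exists>\<epsilon>>0. \<forall>g\<in>gs_step s M h. gs_norm s M h (\<lambda>x. g x - f x) < ennreal \<epsilon> \<longrightarrow> g \<in> U))"

definition gs_topology ::
    "growth \<Rightarrow> (nat \<Rightarrow> real) \<Rightarrow> (real ^ 'n::finite \<Rightarrow> complex) topology" where
  "gs_topology s M = ind_limit {0<..} (gs_step_topology s M)"

definition gs_continuously_included ::
    "'n::finite itself \<Rightarrow> growth \<Rightarrow> (nat \<Rightarrow> real) \<Rightarrow> (nat \<Rightarrow> real) \<Rightarrow> bool" where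
  "gs_continuously_included _ s M N \<longleftrightarrow>
     (gs_class s M :: (real ^ 'n \<Rightarrow> complex) set) \<subseteq> gs_class s N \<and>
     continuous_map (gs_topology s M :: (real ^ 'n \<Rightarrow> complex) topology) (gs_topology s N) (\<lambda>f. f)"


section \<open>Well-definedness\<close>

text \<open>The set of admissible topologies is nonempty, and the inductive limit topology is itself
  admissible, hence the finest one; see \<open>gs_topology_finest\<close>.\<close>

lemma ex_count_list: "\<exists>is. \<forall>i. count_list is i = \<beta> $ i" for \<beta> :: "nat ^ 'n::finite"
proof -
  obtain xs where xs: "set xs = (UNIV :: 'n set)" "distinct xs"
    using finite_distinct_list[OF finite_class.finite_UNIV] by blast
  have rep: "count_list (replicate n i) j = (if i = j then n else 0)" for n and i j :: 'n
    by (induction n) auto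
  have "count_list (concat (map (\<lambda>i. replicate (\<beta> $ i) i) ys)) j = (if j \<in> set ys then \<beta> $ j else 0)"
    if "distinct ys" for ys j
    using that by (induction ys) (auto simp: rep)
  with xs show ?thesis by (metis UNIV_I)
qed

lemma count_list_mi_partial: "count_list (SOME is. \<forall>i. count_list is i = \<beta> $ i) j = \<beta> $ j"
  using someI_ex[OF ex_count_list[of \<beta>]] by blast

lemma istopology_gs_step:
  "istopology (\<lambda>U. U \<subseteq> gs_step s M h \<and>
     (\<forall>f\<in>U. \<exists>\<epsilon>>0. \<forall>g\<in>gs_step s M h. gs_norm s M h (\<lambda>x. g x - f x) < ennreal \<epsilon> \<longrightarrow> g \<in> U))"
  (is "istopology ?P")
proof -
  have "?P (S \<inter> T)" if S: "?P S" and T: "?P T" for S T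
  proof (intro conjI ballI)
    show "S \<inter> T \<subseteq> gs_step s M h" using S by blast
    fix f assume f: "f \<in> S \<inter> T"
    from f S obtain a where a: "a > 0" "\<forall>g\<in>gs_step s M h. gs_norm s M h (\<lambda>x. g x - f x) < ennreal a \<longrightarrow> g \<in> S" by blast
    from f T obtain b where b: "b > 0" "\<forall>g\<in>gs_step s M h. gs_norm s M h (\<lambda>x. g x - f x) < ennreal b \<longrightarrow> g \<in> T" by blast
    show "\<exists>\<epsilon>>0. \<forall>g\<in>gs_step s M h. gs_norm s M h (\<lambda>x. g x - f x) < ennreal \<epsilon> \<longrightarrow> g \<in> S \<inter> T"
    proof (intro exI[of _ "min a b"] conjI ballI impI)
      fix g assume g: "g \<in> gs_step s M h" "gs_norm s M h (\<lambda>x. g x - f x) < ennreal (min a b)"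
      have "ennreal (min a b) \<le> ennreal a" "ennreal (min a b) \<le> ennreal b"
        by (auto intro!: ennreal_leI)
      with g(2) have "gs_norm s M h (\<lambda>x. g x - f x) < ennreal a" "gs_norm s M h (\<lambda>x. g x - f x) < ennreal b"
        by (meson less_le_trans)+
      with a b g show "g \<in> S \<inter> T" by blast
    qed (use a b in auto)
  qed
  moreover have "?P (\<Union>K)" if K: "\<forall>k\<in>K. ?P k" for K
  proof (intro conjI ballI)
    show "\<Union>K \<subseteq> gs_step s M h" using K by blast
    fix f assume "f \<in> \<Union>K"
    then obtain k where k: "k \<in> K" "f \<in> k" by blast
    with K have "\<exists>\<epsilon>>0. \<forall>g\<in>gs_step s M h. gs_norm s M h (\<lambda>x. g x - f x) < ennreal \<epsilon> \<longrightarrow> g \<in> k" by blast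
    then show "\<exists>\<epsilon>>0. \<forall>g\<in>gs_step s M h. gs_norm s M h (\<lambda>x. g x - f x) < ennreal \<epsilon> \<longrightarrow> g \<in> \<Union>K"
      using k by blast
  qed
  ultimately show ?thesis unfolding istopology_def by blast
qed

lemma openin_gs_step_topology:
  "openin (gs_step_topology s M h) U \<longleftrightarrow> U \<subseteq> gs_step s M h \<and>
     (\<forall>f\<in>U. \<exists>\<epsilon>>0. \<forall>g\<in>gs_step s M h. gs_norm s M h (\<lambda>x. g x - f x) < ennreal \<epsilon> \<longrightarrow> g \<in> U)"
  unfolding gs_step_topology_def topology_inverse'[OF istopology_gs_step] ..

lemma topspace_gs_step_topology [simp]: "topspace (gs_step_topology s M h) = gs_step s M h"
proof -
  have "openin (gs_step_topology s M h) (gs_step s M h)"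
    unfolding openin_gs_step_topology using zero_less_one by blast
  then show ?thesis
    unfolding topspace_def openin_gs_step_topology by blast
qed

lemma openin_lc_admissible_ind_limit:
  assumes "lc_admissible I E T" "openin T U" shows "openin (ind_limit I E) U"
  using assms unfolding ind_limit_def by (auto intro: topology_generated_by_Basis)

lemma topspace_ind_limit:
  assumes "lc_admissible I E T" shows "topspace (ind_limit I E) = (\<Union>i\<in>I. topspace (E i))"
proof -
  have "topspace T = (\<Union>i\<in>I. topspace (E i))" using assms by (simp add: lc_admissible_def)
  moreover have "U \<subseteq> (\<Union>i\<in>I. topspace (E i))" if "lc_admissible I E T'" "openin T' U" for U T'
    using that openin_subset unfolding lc_admissible_def by metis
  ultimately show ?thesis
    unfolding ind_limit_def topology_generated_by_topspace
    using assms openin_topspace by blast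
qed

lemma lc_admissible_ind_limit:
  assumes adm: "lc_admissible I E T0" shows "lc_admissible I E (ind_limit I E)"
proof -
  let ?S = "{U. \<exists>T. lc_admissible I E T \<and> openin T U}"
  let ?L = "ind_limit I E"
  note ts = topspace_ind_limit[OF adm]
  have into: "continuous_map X ?L F" if F: "\<And>T. lc_admissible I E T \<Longrightarrow> continuous_map X T F" for X :: "'x topology" and F
    unfolding ind_limit_def
  proof (rule continuous_on_generated_topo)
    fix U assume "U \<in> ?S"
    then obtain T where "lc_admissible I E T" "openin T U" by blast
    then show "openin X (F -` U \<inter> topspace X)"
      using F openin_continuous_map_preimage[of X T F U] by (simp add: vimage_def Int_def conj_commute)
  next
    show "F ` topspace X \<subseteq> \<Union> ?S"
      using F[OF adm] adm openin_topspace[of T0] unfolding continuous_map_def by blast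
  qed
  have idc: "continuous_map ?L T (\<lambda>f. f)" if "lc_admissible I E T" for T
    unfolding continuous_map_def
  proof (intro conjI allI impI)
    have tT: "topspace T = topspace ?L" using that ts by (simp add: lc_admissible_def)
    show "(\<lambda>f. f) \<in> topspace ?L \<rightarrow> topspace T" by (simp add: tT)
    fix U assume U: "openin T U"
    then have "{x \<in> topspace ?L. x \<in> U} = U" using openin_subset[OF U] tT by blast
    then show "openin ?L {x \<in> topspace ?L. x \<in> U}"
      using openin_lc_admissible_ind_limit[OF that U] by simp
  qed
  have add: "continuous_map (prod_topology ?L ?L) ?L (\<lambda>(f, g). \<lambda>x. f x + g x)"
  proof (rule into)
    fix T assume T: "lc_admissible I E T"
    have "continuous_map (prod_topology ?L ?L) (prod_topology T T) (\<lambda>(f, g). (f, g))"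
      using continuous_map_prod_top[of ?L ?L T T "\<lambda>f. f" "\<lambda>f. f"] idc[OF T] by blast
    moreover have "continuous_map (prod_topology T T) T (\<lambda>(f, g). \<lambda>x. f x + g x)"
      using T by (simp add: lc_admissible_def lc_topology_def)
    ultimately have "continuous_map (prod_topology ?L ?L) T ((\<lambda>(f, g). \<lambda>x. f x + g x) \<circ> (\<lambda>(f, g). (f, g)))"
      by (rule continuous_map_compose)
    then show "continuous_map (prod_topology ?L ?L) T (\<lambda>(f, g). \<lambda>x. f x + g x)"
      by (simp add: o_def case_prod_beta')
  qed
  have mul: "continuous_map (prod_topology euclidean ?L) ?L (\<lambda>(c, f). \<lambda>x. c * f x)"
  proof (rule into)
    fix T assume T: "lc_admissible I E T"
    have "continuous_map (prod_topology (euclidean :: complex topology) ?L) (prod_topology euclidean T) (\<lambda>(f, g). (f, g))"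
      by (rule continuous_map_prod_top[of _ _ _ _ "\<lambda>f. f" "\<lambda>f. f", THEN iffD2]) (simp add: idc[OF T])
    moreover have "continuous_map (prod_topology euclidean T) T (\<lambda>(c, f). \<lambda>x. c * f x)"
      using T by (simp add: lc_admissible_def lc_topology_def)
    ultimately have "continuous_map (prod_topology euclidean ?L) T ((\<lambda>(c, f). \<lambda>x. c * f x) \<circ> (\<lambda>(f, g). (f, g)))"
      by (rule continuous_map_compose)
    then show "continuous_map (prod_topology euclidean ?L) T (\<lambda>(c, f). \<lambda>x. c * f x)"
      by (simp add: o_def case_prod_beta')
  qed
  define cvx :: "('b \<Rightarrow> complex) set \<Rightarrow> bool" where
    "cvx V \<longleftrightarrow> (\<forall>f\<in>V. \<forall>g\<in>V. \<forall>t\<in>{0..1}.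
         (\<lambda>x. complex_of_real (1 - t) * f x + complex_of_real t * g x) \<in> V)" for V
  have base: "\<exists>V. openin ?L V \<and> (\<lambda>x. 0) \<in> V \<and> V \<subseteq> U \<and> cvx V"
    if "generate_topology_on ?S U" "(\<lambda>x. 0) \<in> U" for U
    using that
  proof (induction U)
    case (Int a b)
    from Int obtain V W where "openin ?L V \<and> (\<lambda>x. 0) \<in> V \<and> V \<subseteq> a \<and> cvx V"
      "openin ?L W \<and> (\<lambda>x. 0) \<in> W \<and> W \<subseteq> b \<and> cvx W" by blast
    then show ?case by (intro exI[of _ "V \<inter> W"]) (auto simp: cvx_def)
  next
    case (UN K)
    then show ?case by (meson UnionE Union_upper subset_trans)
  next
    case (Basis U)
    then obtain T where T: "lc_admissible I E T" "openin T U" by blast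
    with Basis obtain V where "openin T V \<and> (\<lambda>x. 0) \<in> V \<and> V \<subseteq> U \<and> cvx V"
      unfolding lc_admissible_def lc_topology_def cvx_def[abs_def] by meson
    with openin_lc_admissible_ind_limit[OF T(1)] show ?case by blast
  qed auto
  have inc: "continuous_map (E i) ?L (\<lambda>f. f)" if "i \<in> I" for i
    using that by (intro into) (simp add: lc_admissible_def)
  have "lc_topology ?L"
    unfolding lc_topology_def using add mul base unfolding cvx_def
    by (auto simp: ind_limit_def openin_topology_generated_by_iff)
  then show ?thesis unfolding lc_admissible_def using ts inc by blast
qed

lemma partials_lin:
  assumes "smooth f" "smooth g"
  shows "partials is (\<lambda>x. a * f x + b * g x) = (\<lambda>x. a * partials is f x + b * partials is g x)"
proof (induction "is")
  case (Cons i "is")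
  have d: "(\<lambda>t::real. partials is f (x + t *\<^sub>R axis i 1)) differentiable (at 0)"
     "(\<lambda>t::real. partials is g (x + t *\<^sub>R axis i 1)) differentiable (at 0)" for x
    using assms unfolding smooth_def has_partial_def by auto
  have "partials (i # is) (\<lambda>x. a * f x + b * g x) = partial i (\<lambda>x. a * partials is f x + b * partials is g x)"
    using Cons by (simp add: partials_def)
  also have "\<dots> = (\<lambda>x. a * partial i (partials is f) x + b * partial i (partials is g) x)"
    unfolding partial_def
    by (intro ext vector_derivative_at derivative_intros has_vector_derivative_mult_right
        d[unfolded vector_derivative_works])
  finally show ?case by (simp add: partials_def)
qed (simp add: partials_def)

lemma smooth_lin:
  assumes "smooth f" "smooth g"
  shows "smooth (\<lambda>x. a * f x + b * g x)"
  unfolding smooth_def partials_lin[OF assms]  has_partial_def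
  using assms unfolding smooth_def has_partial_def
  by (auto intro!: continuous_intros derivative_intros)

lemma gs_norm_lin:
  assumes "smooth f" "smooth g"
  shows "gs_norm s M h (\<lambda>x. a * f x + b * g x) \<le> ennreal (norm a) * gs_norm s M h f + ennreal (norm b) * gs_norm s M h g"
proof -
  have 1: "sup_norm (\<lambda>x. complex_of_real (mi_monom \<alpha> x) * mi_partial \<beta> (\<lambda>x. a * f x + b * g x) x) / ennreal w
     \<le> ennreal (norm a) * (sup_norm (\<lambda>x. complex_of_real (mi_monom \<alpha> x) * mi_partial \<beta> f x) / ennreal w)
      + ennreal (norm b) * (sup_norm (\<lambda>x. complex_of_real (mi_monom \<alpha> x) * mi_partial \<beta> g x) / ennreal w)"
    (is "?A / _ \<le> _ * (?B / _) + _ * (?C / _)") for \<alpha> \<beta> w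
  proof -
    have "?A \<le> ennreal (norm a) * ?B + ennreal (norm b) * ?C"
      unfolding sup_norm_def
    proof (rule SUP_least)
      fix x
      let ?m = "complex_of_real (mi_monom \<alpha> x)"
      have "norm (?m * mi_partial \<beta> (\<lambda>x. a * f x + b * g x) x)
        = norm (a * (?m * mi_partial \<beta> f x) + b * (?m * mi_partial \<beta> g x))"
        by (simp add: mi_partial_def partials_lin[OF assms] algebra_simps)
      also have "\<dots> \<le> norm a * norm (?m * mi_partial \<beta> f x) + norm b * norm (?m * mi_partial \<beta> g x)"
        by (metis norm_triangle_ineq norm_mult)
      finally have "ennreal (norm (?m * mi_partial \<beta> (\<lambda>x. a * f x + b * g x) x)) \<le>
        ennreal (norm a) * ennreal (norm (?m * mi_partial \<beta> f x)) + ennreal (norm b) * ennreal (norm (?m * mi_partial \<beta> g x))"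
        by (simp add: ennreal_mult[symmetric] ennreal_plus[symmetric] ennreal_leI del: ennreal_plus)
      also have "\<dots> \<le> ennreal (norm a) * (SUP x. ennreal (norm (complex_of_real (mi_monom \<alpha> x) * mi_partial \<beta> f x))) 
         + ennreal (norm b) * (SUP x. ennreal (norm (complex_of_real (mi_monom \<alpha> x) * mi_partial \<beta> g x)))"
        by (intro add_mono mult_left_mono SUP_upper) auto
      finally show "ennreal (norm (?m * mi_partial \<beta> (\<lambda>x. a * f x + b * g x) x)) \<le> \<dots>" .
    qed
    then have "?A / ennreal w \<le> (ennreal (norm a) * ?B + ennreal (norm b) * ?C) / ennreal w"
      by (rule divide_right_mono_ennreal)
    then show ?thesis by (simp add: ennreal_times_divide add_divide_distrib_ennreal)
  qed
  show ?thesis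
    unfolding gs_norm_def
    apply (rule SUP_least, clarify)
    apply (rule order_trans[OF 1])
    apply (intro add_mono mult_left_mono)
    subgoal for a b by (rule SUP_upper2[of "(a,b)"]) simp_all
    subgoal by simp
    subgoal for a b by (rule SUP_upper2[of "(a,b)"]) simp_all
    subgoal by simp
    done
qed


lemma gs_norm_antimono:
  assumes M: "\<And>p. M p > 0" and h: "0 < h" "h \<le> k"
  shows "gs_norm s M k f \<le> gs_norm s M h f"
proof -
  have w: "0 < gs_weight s M \<alpha> \<beta>" for \<alpha> \<beta> :: "nat ^ 'b" using M by (cases s) auto
  have hn: "0 < h ^ n" "h ^ n \<le> k ^ n" for n using h by (auto intro: power_mono)
  have dv: "x / ennreal b \<le> x / ennreal a" if "0 < a" "a \<le> b" for x a b
    using that by (auto simp: divide_ennreal_def inverse_ennreal intro!: mult_left_mono ennreal_leI le_imp_inverse_le)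
  show ?thesis unfolding gs_norm_def
  proof (intro SUP_mono, clarify)
    fix \<alpha> \<beta> :: "nat ^ 'a"
    have "h ^ mi_abs (\<alpha> + \<beta>) * gs_weight s M \<alpha> \<beta> \<le> k ^ mi_abs (\<alpha> + \<beta>) * gs_weight s M \<alpha> \<beta>"
      by (rule mult_right_mono[OF hn(2) less_imp_le[OF w]])
    from dv[OF mult_pos_pos[OF hn(1) w] this] show "\<exists>m\<in>UNIV.
     sup_norm (\<lambda>x. complex_of_real (mi_monom \<alpha> x) * mi_partial \<beta> f x) /
       ennreal (k ^ mi_abs (\<alpha> + \<beta>) * gs_weight s M \<alpha> \<beta>)
       \<le> (case m of (\<alpha>, \<beta>) \<Rightarrow> sup_norm (\<lambda>x. complex_of_real (mi_monom \<alpha> x) * mi_partial \<beta> f x) /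
              ennreal (h ^ mi_abs (\<alpha> + \<beta>) * gs_weight s M \<alpha> \<beta>))"
      by (intro bexI[of _ "(\<alpha>, \<beta>)"]) simp_all
  qed
qed

lemma gs_class_lin:
  assumes M: "\<And>p. M p > 0" and f: "f \<in> gs_class s M" and g: "g \<in> gs_class s M"
  shows "(\<lambda>x. a * f x + b * g x) \<in> gs_class s M"
proof -
  obtain h k where h: "h > 0" "gs_norm s M h f < \<infinity>" and k: "k > 0" "gs_norm s M k g < \<infinity>"
    using f g by (auto simp: gs_class_def)
  have sm: "smooth f" "smooth g" using f g by (auto simp: gs_class_def)
  let ?m = "max h k"
  have "gs_norm s M ?m f \<le> gs_norm s M h f" "gs_norm s M ?m g \<le> gs_norm s M k g"
    by (rule gs_norm_antimono; use h k M in simp)+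
  then have "gs_norm s M ?m f < \<infinity>" "gs_norm s M ?m g < \<infinity>"
    using h(2) k(2) by (meson le_less_trans)+
  then have "ennreal (norm a) * gs_norm s M ?m f + ennreal (norm b) * gs_norm s M ?m g < \<infinity>"
    by (simp add: ennreal_mult_less_top)
  with gs_norm_lin[OF sm, of s M ?m a b] have "gs_norm s M ?m (\<lambda>x. a * f x + b * g x) < \<infinity>" by (rule le_less_trans)
  with smooth_lin[OF sm] h show ?thesis by (auto simp: gs_class_def intro!: exI[of _ ?m])
qed

lemma gs_class_eq: "gs_class s M = (\<Union>h\<in>{0<..}. gs_step s M h)"
  by (auto simp: gs_class_def gs_step_def)

lemma lc_admissible_gs:
  assumes M: "\<And>p. M p > 0"
  shows "\<exists>T. lc_admissible {0<..} (gs_step_topology s M :: _ \<Rightarrow> (real ^ 'n::finite \<Rightarrow> complex) topology) T"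
proof -
  define S where "S = (gs_class s M :: (real ^ 'n \<Rightarrow> complex) set)"
  define T where "T = topology (\<lambda>U. U = {} \<or> U = S)"
  have "istopology (\<lambda>U. U = {} \<or> U = S)" unfolding istopology_def by auto
  then have op: "openin T U \<longleftrightarrow> U = {} \<or> U = S" for U unfolding T_def by (simp add: topology_inverse')
  have ts: "topspace T = S" unfolding topspace_def op by auto
  have cm: "continuous_map X T F" if "F ` topspace X \<subseteq> S" for X :: "'x topology" and F
  proof -
    have "{x \<in> topspace X. F x \<in> S} = topspace X" using that by auto
    then show ?thesis unfolding continuous_map_def using that by (auto simp: op ts)
  qed
  have l: "(\<lambda>x. a * f x + b * g x) \<in> S" if "f \<in> S" "g \<in> S" for f g a b
    using gs_class_lin[of M f s g a b] M that by (auto simp: S_def)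
  have "lc_topology T" unfolding lc_topology_def
    apply (intro conjI allI impI cm)
    subgoal using l[of _ _ 1 1] by (auto simp: ts)
    subgoal using l[of _ _ _ 0] by (auto simp: ts)
    subgoal for U by (rule exI[of _ S]) (use l in \<open>auto simp: op\<close>)
    done
  moreover have "\<forall>i\<in>{0<..}. continuous_map (gs_step_topology s M i) T (\<lambda>f. f)"
    by (auto intro!: cm simp: S_def gs_class_eq)
  moreover have "topspace T = (\<Union>i\<in>{0<..}. topspace (gs_step_topology s M i))"
    by (simp add: ts S_def gs_class_eq)
  ultimately show ?thesis unfolding lc_admissible_def by blast
qed

lemma topspace_gs_topology:
  assumes M: "\<And>p. M p > 0" shows "topspace (gs_topology s M) = gs_class s M"
proof -
  obtain T where "lc_admissible {0<..} (gs_step_topology s M :: _ \<Rightarrow> (real ^ 'a \<Rightarrow> complex) topology) T"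
    using lc_admissible_gs[of M s] M by blast
  from topspace_ind_limit[OF this] show ?thesis
    unfolding gs_topology_def gs_class_eq by simp
qed

lemma gs_topology_finest:
  assumes M: "\<And>p. M p > 0" 
  shows "lc_admissible {0<..} (gs_step_topology s M) (gs_topology s M :: (real ^ 'a::finite \<Rightarrow> complex) topology)"
proof -
  obtain T where "lc_admissible {0<..} (gs_step_topology s M :: _ \<Rightarrow> (real ^ 'a \<Rightarrow> complex) topology) T"
    using lc_admissible_gs[of M s] M by blast
  from lc_admissible_ind_limit[OF this] show ?thesis
    unfolding gs_topology_def .
qed

end

theory Submission
  imports Defs
begin

text \<open>If \<open>M p \<le> C ^ p * N p\<close>, then the seminorm of the class of \<open>N\<close> with parameter \<open>C * h\<close> is at most the one
  of the class of \<open>M\<close> with parameter \<open>h\<close> (\<open>gs_norm_mono_weight\<close>). Each step of the inductive limit of \<open>M\<close>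
  therefore maps continuously into a step of the one of \<open>N\<close>, and the universal property of inductive
  limits gives the continuity of the inclusion.

  Conversely, let \<open>M\<close> be log-convex and non-quasianalytic, and let \<open>q k = M k / M (k - 1)\<close>. It suffices to
  find one function in the class of \<open>M\<close> whose \<open>p\<close>-th derivative at the origin is at least \<open>(1/2) ^ p * M p\<close> in
  modulus, because its membership in the class of \<open>N\<close> bounds these derivatives by \<open>C * h ^ p * N p\<close>. The
  function is \<open>f x = (\<Sum>k. (1/2) ^ k * M k / q k ^ k * exp (\<i> * q k * x)) * exp (- x\<^sup>2 / 2)\<close>.

  By log-convexity, \<open>M k * q k ^ (j - k) \<le> M j\<close> with equality for \<open>j = k\<close>. Hence the \<open>j\<close>-th derivative of the
  series is bounded by \<open>2 * M j\<close> everywhere, while at the origin it equals \<open>\<i> ^ j\<close> times a real number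
  not less than \<open>(1/2) ^ j * M j\<close>. The Gaussian provides the decay. Its derivatives are controlled by
  factorials (\<open>gauss_deriv_bound\<close>), and non-quasianalyticity forces \<open>fact n \<le> S ^ n * M n\<close>
  (\<open>fact_le_non_quasianalytic\<close>), so that \<open>f\<close> belongs to the class of \<open>M\<close>. A cutoff function of compact
  support could be used in place of the Gaussian, but would itself have to be constructed. The
  price for a factor that is not constant near the origin is a possible cancellation in the Leibniz
  formula; it does not occur, since the \<open>n\<close>-th derivative of the Gaussian at the origin is also \<open>\<i> ^ n\<close> times
  a non-negative real number, so that all terms have the same phase (\<open>leibniz_same_phase\<close>).\<close>

section \<open>Continuity of the inclusion\<close>

text \<open>The factor \<open>C ^ |\<alpha> + \<beta>|\<close> that separates the two weights is absorbed into the parameter \<open>h\<close>. This works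
  for both kinds of growth, because \<open>|\<alpha> + \<beta>| = |\<alpha>| + |\<beta>|\<close>.\<close>
lemma gs_norm_mono_weight:
  fixes f :: "real ^ 'n::finite \<Rightarrow> complex"
  assumes M: "\<And>p. M p > 0" and N: "\<And>p. N p > 0" and C: "C \<ge> 1"
    and MN: "\<And>p. M p \<le> C ^ p * N p" and h: "h > 0"
  shows "gs_norm s N (C * h) f \<le> gs_norm s M h f"
proof -
  have dv: "x / ennreal b \<le> x / ennreal a" if "0 < a" "a \<le> b" for x a b
    using that by (auto simp: divide_ennreal_def inverse_ennreal
        intro!: mult_left_mono ennreal_leI le_imp_inverse_le)
  have abs_add: "mi_abs (\<alpha> + \<beta>) = mi_abs \<alpha> + mi_abs \<beta>" for \<alpha> \<beta> :: "nat ^ 'n"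
    by (simp add: mi_abs_def sum.distrib)
  have w: "0 < gs_weight s M \<alpha> \<beta>" for \<alpha> \<beta> :: "nat ^ 'n"
    using M by (cases s) auto
  have le: "gs_weight s M \<alpha> \<beta> \<le> C ^ mi_abs (\<alpha> + \<beta>) * gs_weight s N \<alpha> \<beta>" for \<alpha> \<beta> :: "nat ^ 'n"
  proof (cases s)
    case Separated
    have "M (mi_abs \<alpha>) * M (mi_abs \<beta>) \<le> (C ^ mi_abs \<alpha> * N (mi_abs \<alpha>)) * (C ^ mi_abs \<beta> * N (mi_abs \<beta>))"
      using M N C by (intro mult_mono MN) (auto simp: less_imp_le)
    then show ?thesis by (simp add: Separated abs_add power_add mult_ac)
  qed (simp add: MN)
  have le': "h ^ mi_abs (\<alpha> + \<beta>) * gs_weight s M \<alpha> \<beta> \<le> (C * h) ^ mi_abs (\<alpha> + \<beta>) * gs_weight s N \<alpha> \<beta>"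
    for \<alpha> \<beta> :: "nat ^ 'n"
    using mult_left_mono[OF le[of \<alpha> \<beta>], of "h ^ mi_abs (\<alpha> + \<beta>)"] h
    by (simp add: power_mult_distrib mult_ac)
  have "sup_norm F / ennreal ((C * h) ^ mi_abs (\<alpha> + \<beta>) * gs_weight s N \<alpha> \<beta>)
      \<le> sup_norm F / ennreal (h ^ mi_abs (\<alpha> + \<beta>) * gs_weight s M \<alpha> \<beta>)"
    for F :: "real ^ 'n \<Rightarrow> complex" and \<alpha> \<beta> :: "nat ^ 'n"
    using h w by (intro dv le') simp
  then show ?thesis unfolding gs_norm_def by (intro SUP_mono') (auto split: prod.split)
qed

lemma continuous_map_gs_step:
  assumes le: "\<And>f :: real ^ 'n::finite \<Rightarrow> complex. gs_norm s N k f \<le> gs_norm s M h f"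
  shows "continuous_map (gs_step_topology s M h) (gs_step_topology s N k)
    (\<lambda>f :: real ^ 'n \<Rightarrow> complex. f)"
proof -
  have sub: "f \<in> gs_step s N k" if "f \<in> gs_step s M h" for f :: "real ^ 'n \<Rightarrow> complex"
    using that le[of f] by (auto simp: gs_step_def intro: le_less_trans)
  show ?thesis
    unfolding continuous_map_def openin_gs_step_topology topspace_gs_step_topology
  proof (intro conjI allI impI ballI)
    fix U and f :: "real ^ 'n \<Rightarrow> complex"
    assume U: "U \<subseteq> gs_step s N k \<and> (\<forall>f\<in>U. \<exists>\<epsilon>>0. \<forall>g\<in>gs_step s N k.
        gs_norm s N k (\<lambda>x. g x - f x) < ennreal \<epsilon> \<longrightarrow> g \<in> U)"
      and "f \<in> {f \<in> gs_step s M h. f \<in> U}"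
    then obtain \<epsilon> where "\<epsilon> > 0" "\<forall>g\<in>gs_step s N k. gs_norm s N k (\<lambda>x. g x - f x) < ennreal \<epsilon> \<longrightarrow> g \<in> U"
      by blast
    then show "\<exists>\<epsilon>>0. \<forall>g\<in>gs_step s M h. gs_norm s M h (\<lambda>x. g x - f x) < ennreal \<epsilon> \<longrightarrow>
        g \<in> {f \<in> gs_step s M h. f \<in> U}"
      using sub le by (intro exI[of _ \<epsilon>]) (auto intro: le_less_trans)
  qed (use sub in auto)
qed

text \<open>Needed to pull the topology of the larger class back to the smaller one: the trace is then a
  competitor in the definition of the inductive limit topology of the smaller class.\<close>
lemma lc_topology_subtopology:
  assumes T: "lc_topology T"
    and lin: "\<And>f g a b. f \<in> W \<Longrightarrow> g \<in> W \<Longrightarrow> (\<lambda>x. a * f x + b * g x) \<in> W"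
  shows "lc_topology (subtopology T W)"
proof -
  have add: "(\<lambda>x. f x + g x) \<in> W" if "f \<in> W" "g \<in> W" for f g
    using lin[OF that, of 1 1] by simp
  have mul: "(\<lambda>x. c * f x) \<in> W" if "f \<in> W" for f c
    using lin[OF that that, of c 0] by simp
  have "continuous_map (prod_topology (subtopology T W) (subtopology T W)) (subtopology T W)
      (\<lambda>(f, g). \<lambda>x. f x + g x)"
    unfolding continuous_map_in_subtopology
  proof
    have "continuous_map (subtopology (prod_topology T T) (W \<times> W)) T (\<lambda>(f, g). \<lambda>x. f x + g x)"
      using T by (intro continuous_map_from_subtopology) (simp add: lc_topology_def)
    then show "continuous_map (prod_topology (subtopology T W) (subtopology T W)) T
        (\<lambda>(f, g). \<lambda>x. f x + g x)"
      by (simp add: subtopology_Times)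
  qed (use add in auto)
  moreover have "continuous_map (prod_topology euclidean (subtopology T W)) (subtopology T W)
      (\<lambda>(c, f). \<lambda>x. c * f x)"
    unfolding continuous_map_in_subtopology
  proof
    have "continuous_map (subtopology (prod_topology euclidean T) (UNIV \<times> W)) T (\<lambda>(c, f). \<lambda>x. c * f x)"
      using T by (intro continuous_map_from_subtopology) (simp add: lc_topology_def)
    then show "continuous_map (prod_topology euclidean (subtopology T W)) T (\<lambda>(c, f). \<lambda>x. c * f x)"
      by (simp add: subtopology_Times)
  qed (use mul in auto)
  moreover have "\<exists>V. openin (subtopology T W) V \<and> (\<lambda>x. 0) \<in> V \<and> V \<subseteq> U \<and>
       (\<forall>f\<in>V. \<forall>g\<in>V. \<forall>t\<in>{0..1}. (\<lambda>x. complex_of_real (1 - t) * f x + complex_of_real t * g x) \<in> V)"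
    if "openin (subtopology T W) U" "(\<lambda>x. 0) \<in> U" for U
  proof -
    from that obtain U' where U': "openin T U'" "U = U' \<inter> W" by (auto simp: openin_subtopology)
    with that have "(\<lambda>x. 0) \<in> U'" "(\<lambda>x. 0) \<in> W" by auto
    with T[unfolded lc_topology_def, THEN conjunct2, THEN conjunct2, THEN spec, of U'] U'(1)
    obtain V where "openin T V" "(\<lambda>x. 0) \<in> V" "V \<subseteq> U'"
       "\<forall>f\<in>V. \<forall>g\<in>V. \<forall>t\<in>{0..1}. (\<lambda>x. complex_of_real (1 - t) * f x + complex_of_real t * g x) \<in> V"
      by (elim impE) auto
    with \<open>(\<lambda>x. 0) \<in> W\<close> U' show ?thesis
      by (intro exI[of _ "V \<inter> W"]) (auto simp: openin_subtopology intro: lin)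
  qed
  ultimately show ?thesis unfolding lc_topology_def by blast
qed

lemma preceq_imp_gs_continuously_included:
  assumes M: "\<And>p. M p > 0" and N: "\<And>p. N p > 0" and MN: "M \<preceq> N"
  shows "gs_continuously_included TYPE('n::finite) s M N"
proof -
  let ?A = "gs_class s M :: (real ^ 'n \<Rightarrow> complex) set"
  let ?B = "gs_class s N :: (real ^ 'n \<Rightarrow> complex) set"
  let ?T = "gs_topology s N :: (real ^ 'n \<Rightarrow> complex) topology"
  from MN obtain C where C: "C \<ge> 1" "\<And>p. M p \<le> C ^ p * N p" unfolding preceq_def by blast
  have le: "gs_norm s N (C * h) f \<le> gs_norm s M h f" if "h > 0" for h and f :: "real ^ 'n \<Rightarrow> complex"
    by (rule gs_norm_mono_weight) (use M N C that in auto)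
  have pos: "C * h > 0" if "h > 0" for h using that C by simp
  have sub: "?A \<subseteq> ?B"
    using le pos unfolding gs_class_def by (blast intro: le_less_trans)
  have fin: "lc_admissible {0<..} (gs_step_topology s N) ?T"
    using gs_topology_finest[of N s] N by blast
  have tsN: "topspace ?T = ?B" using topspace_gs_topology[of N s] N by blast
  have tsM: "topspace (gs_topology s M) = ?A" using topspace_gs_topology[of M s] M by blast
  \<comment> \<open>The trace of the target topology is admissible for the steps of the smaller class, hence coarser
    than the inductive limit topology there; this is the universal property of inductive limits.\<close>
  have adm: "lc_admissible {0<..} (gs_step_topology s M) (subtopology ?T ?A)"
    unfolding lc_admissible_def
  proof (intro conjI ballI)
    show "lc_topology (subtopology ?T ?A)"
      using fin M by (intro lc_topology_subtopology gs_class_lin) (auto simp: lc_admissible_def)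
    show "topspace (subtopology ?T ?A) = (\<Union>h\<in>{0<..}. topspace (gs_step_topology s M h))"
      using sub by (auto simp: tsN gs_class_eq)
    fix h :: real assume h: "h \<in> {0<..}"
    have "continuous_map (gs_step_topology s M h) (gs_step_topology s N (C * h)) (\<lambda>f :: real ^ 'n \<Rightarrow> complex. f)"
      using h by (auto intro: continuous_map_gs_step le)
    moreover have "continuous_map (gs_step_topology s N (C * h)) ?T (\<lambda>f. f)"
      using fin pos h by (auto simp: lc_admissible_def)
    ultimately have "continuous_map (gs_step_topology s M h) ?T (\<lambda>f. f)"
      using continuous_map_compose by (fastforce simp: o_def)
    then show "continuous_map (gs_step_topology s M h) (subtopology ?T ?A) (\<lambda>f. f)"
      using h by (auto simp: continuous_map_in_subtopology gs_class_eq)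
  qed
  have "continuous_map (gs_topology s M) ?T (\<lambda>f. f)"
    unfolding continuous_map_def
  proof (intro conjI allI impI)
    fix U assume "openin ?T U"
    then have "openin (subtopology ?T ?A) (U \<inter> ?A)" by (auto simp: openin_subtopology)
    then have "openin (gs_topology s M) (U \<inter> ?A)"
      unfolding gs_topology_def[of s M] by (rule openin_lc_admissible_ind_limit[OF adm])
    then show "openin (gs_topology s M) {f \<in> topspace (gs_topology s M). f \<in> U}"
      by (simp add: tsM Int_def conj_commute)
  qed (use sub tsM tsN in auto)
  with sub show ?thesis unfolding gs_continuously_included_def by blast
qed

section \<open>Log-convex sequences and their characteristic functions\<close>

definition quot :: "(nat \<Rightarrow> real) \<Rightarrow> nat \<Rightarrow> real" where
  "quot M k = M k / M (k - 1)"

definition theta_coeff :: "(nat \<Rightarrow> real) \<Rightarrow> nat \<Rightarrow> real" where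
  "theta_coeff M k = (1/2) ^ k * M k / quot M k ^ k"

text \<open>The \<open>j\<close>-th derivative of \<open>x \<mapsto> (\<Sum>k. theta_coeff M k * cis (quot M k * x))\<close>, a characteristic function of
  the weight sequence \<open>M\<close>: its derivatives are bounded on the line by constant multiples of \<open>M j\<close>, and
  those at the origin attain this size up to a geometric factor.\<close>
definition theta :: "(nat \<Rightarrow> real) \<Rightarrow> nat \<Rightarrow> real \<Rightarrow> complex" where
  "theta M j x = (\<Sum>k. of_real (theta_coeff M k * quot M k ^ j) * \<i> ^ j * cis (quot M k * x))"

context
  fixes M :: "nat \<Rightarrow> real"
  assumes LC: "M \<in> LC"
begin

lemma LC_pos: "M p > 0" and LC_0: "M 0 = 1"
  using LC by (auto simp: LC_def)

lemma quot_pos: "quot M k > 0"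
  by (simp add: quot_def LC_pos)

lemma LC_Suc: "M (Suc k) = M k * quot M (Suc k)"
  using LC_pos[of k] by (simp add: quot_def)

lemma quot_mono: "i \<le> j \<Longrightarrow> quot M i \<le> quot M j"
proof (induction rule: dec_induct)
  case (step n)
  have "quot M n \<le> quot M (Suc n)"
  proof (cases n)
    case 0
    then show ?thesis using LC by (simp add: quot_def LC_def)
  next
    case (Suc m)
    have "(M n)\<^sup>2 \<le> M (n - 1) * M (n + 1)" using LC Suc unfolding LC_def by fastforce
    then show ?thesis using Suc LC_pos[of m] LC_pos[of n]
      by (simp add: quot_def divide_simps power2_eq_square mult_ac)
  qed
  with step show ?case by simp
qed simp

lemma LC_mult_le: "M a * M b \<le> M (a + b)"
proof (induction b)
  case (Suc b)
  have "M a * M (Suc b) = M a * M b * quot M (Suc b)" by (simp add: LC_Suc)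
  also have "\<dots> \<le> M (a + b) * quot M (Suc (a + b))"
    using Suc LC_pos quot_pos by (intro mult_mono quot_mono) (auto simp: less_imp_le)
  finally show ?case by (simp add: LC_Suc)
qed (simp add: LC_0)

text \<open>Among the numbers \<open>q ^ j / M j\<close> with \<open>q = quot M k\<close>, the largest is attained at \<open>j = k\<close>: in passing from
  \<open>j\<close> to \<open>j + 1\<close> they are multiplied by \<open>q / quot M (j + 1)\<close>, and the quotients increase.\<close>
lemma LC_quot_pow_le: "M k * quot M k ^ j \<le> M j * quot M k ^ k"
proof (cases "k \<le> j")
  case True
  then show ?thesis
  proof (induction j rule: dec_induct)
    case (step j)
    have "M k * quot M k ^ Suc j = (M k * quot M k ^ j) * quot M k" by simp
    also have "\<dots> \<le> (M j * quot M k ^ k) * quot M (Suc j)"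
      using LC_pos quot_pos step
      by (intro mult_mono[OF _ quot_mono]) (auto simp: less_imp_le)
    finally show ?case by (simp add: LC_Suc mult_ac)
  qed simp
next
  case False
  have "M l * quot M k ^ j \<le> M j * quot M k ^ l" if "j \<le> l" "l \<le> k" for l
    using that
  proof (induction l rule: dec_induct)
    case (step l)
    have "M (Suc l) * quot M k ^ j = (M l * quot M k ^ j) * quot M (Suc l)" by (simp add: LC_Suc)
    also have "\<dots> \<le> (M j * quot M k ^ l) * quot M k"
      using LC_pos quot_pos step
      by (intro mult_mono[OF _ quot_mono]) (auto simp: less_imp_le)
    finally show ?case by (simp add: mult_ac)
  qed simp
  with False show ?thesis by simp
qed

text \<open>The terms \<open>1 / quot M k\<close> decrease and have a finite sum \<open>S\<close>, so \<open>k / quot M k \<le> S\<close>; the product of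
  these estimates compares \<open>M\<close> with the factorials. This is what places the Gaussian in the class of \<open>M\<close>.\<close>
lemma fact_le_non_quasianalytic:
  assumes "non_quasianalytic M"
  obtains S where "S > 0" "\<And>n. fact n \<le> S ^ n * M n"
proof
  have sm: "summable (\<lambda>k. 1 / quot M (Suc k))"
    using assms by (simp add: non_quasianalytic_def quot_def)
  define S where "S = (\<Sum>k. 1 / quot M (Suc k))"
  show "S > 0" unfolding S_def using sm quot_pos by (intro suminf_pos) auto
  have q: "real (Suc n) \<le> S * quot M (Suc n)" for n
  proof -
    have "real (Suc n) / quot M (Suc n) = (\<Sum>k<Suc n. 1 / quot M (Suc n))" by simp
    also have "\<dots> \<le> (\<Sum>k<Suc n. 1 / quot M (Suc k))"
      using quot_pos by (intro sum_mono frac_le quot_mono) auto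
    also have "\<dots> \<le> S" unfolding S_def
      using sm quot_pos by (intro sum_le_suminf) (auto simp: less_imp_le)
    finally show ?thesis using quot_pos by (simp add: divide_simps)
  qed
  show "fact n \<le> S ^ n * M n" for n
  proof (induction n)
    case (Suc n)
    have "fact (Suc n) = real (Suc n) * fact n" by simp
    also have "\<dots> \<le> (S * quot M (Suc n)) * (S ^ n * M n)"
      using Suc q[of n] \<open>S > 0\<close> quot_pos[of "Suc n"] by (intro mult_mono) (auto simp: less_imp_le)
    finally show ?case by (simp add: LC_Suc mult_ac)
  qed (simp add: LC_0)
qed

text \<open>\<open>LC_quot_pow_le\<close> bounds \<open>M k * quot M k ^ (j - k)\<close> by \<open>M j\<close>, and the factor \<open>(1/2) ^ k\<close> of the coefficients
  is left over to make the series converge.\<close>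
lemma theta_coeff_bounds: "0 \<le> theta_coeff M k * quot M k ^ j" "theta_coeff M k * quot M k ^ j \<le> M j * (1/2) ^ k"
proof -
  show "0 \<le> theta_coeff M k * quot M k ^ j"
    using quot_pos[of k] LC_pos[of k] by (simp add: theta_coeff_def)
  have "theta_coeff M k * quot M k ^ j = (1/2) ^ k * ((M k * quot M k ^ j) / quot M k ^ k)"
    by (simp add: theta_coeff_def)
  also have "\<dots> \<le> (1/2) ^ k * M j"
    using LC_quot_pow_le[of k j] quot_pos[of k] by (intro mult_left_mono) (auto simp: divide_simps mult_ac)
  finally show "theta_coeff M k * quot M k ^ j \<le> M j * (1/2) ^ k" by (simp add: mult_ac)
qed

lemma summable_theta_coeff: "summable (\<lambda>k. theta_coeff M k * quot M k ^ j)"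
proof (rule summable_comparison_test')
  show "summable (\<lambda>k. M j * (1/2) ^ k)" by (intro summable_mult summable_geometric) simp
  show "norm (theta_coeff M k * quot M k ^ j) \<le> M j * (1/2) ^ k" if "k \<ge> 0" for k
    using theta_coeff_bounds[of k j] by simp
qed

lemma norm_theta_term: "norm (of_real (theta_coeff M k * quot M k ^ j) * \<i> ^ j * cis (quot M k * x)) = theta_coeff M k * quot M k ^ j"
  using theta_coeff_bounds(1)[of k j] by (simp add: norm_mult norm_power del: of_real_mult)

lemma norm_theta_le: "norm (theta M j x) \<le> 2 * M j"
proof -
  have "norm (theta M j x) \<le> (\<Sum>k. norm (of_real (theta_coeff M k * quot M k ^ j) * \<i> ^ j * cis (quot M k * x)))"
    unfolding theta_def by (rule summable_norm) (simp only: norm_theta_term summable_theta_coeff)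
  also have "\<dots> = (\<Sum>k. theta_coeff M k * quot M k ^ j)" by (simp only: norm_theta_term)
  also have "\<dots> \<le> (\<Sum>k. M j * (1/2) ^ k)"
    by (intro suminf_le theta_coeff_bounds(2) summable_theta_coeff summable_mult summable_geometric) simp
  also have "\<dots> = M j * (\<Sum>k. (1/2) ^ k)" by (intro suminf_mult summable_geometric) simp
  also have "\<dots> = 2 * M j" by (subst suminf_geometric) simp_all
  finally show ?thesis .
qed

text \<open>At the origin all terms of the series have the phase \<open>\<i> ^ j\<close>, so nothing cancels, and the single term
  \<open>k = j\<close>, where \<open>LC_quot_pow_le\<close> is an equality, already contributes \<open>(1/2) ^ j * M j\<close>.\<close>
lemma theta_at_0:
  "theta M j 0 = of_real (\<Sum>k. theta_coeff M k * quot M k ^ j) * \<i> ^ j"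
  "M j * (1/2) ^ j \<le> (\<Sum>k. theta_coeff M k * quot M k ^ j)"
proof -
  have "theta M j 0 = (\<Sum>k. of_real (theta_coeff M k * quot M k ^ j)) * \<i> ^ j"
    by (simp only: theta_def suminf_mult2[OF summable_of_real[OF summable_theta_coeff]]
        mult_zero_right cis_zero mult_1_right)
  then show "theta M j 0 = of_real (\<Sum>k. theta_coeff M k * quot M k ^ j) * \<i> ^ j"
    by (simp only: suminf_of_real[OF summable_theta_coeff])
  have "M j * (1/2) ^ j = (\<Sum>k\<in>{j}. theta_coeff M k * quot M k ^ j)"
    using quot_pos[of j] by (simp add: theta_coeff_def)
  also have "\<dots> \<le> (\<Sum>k. theta_coeff M k * quot M k ^ j)"
    using theta_coeff_bounds(1) by (intro sum_le_suminf summable_theta_coeff) auto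
  finally show "M j * (1/2) ^ j \<le> (\<Sum>k. theta_coeff M k * quot M k ^ j)" .
qed

end

lemma has_vector_derivative_suminf:
  fixes f f' :: "nat \<Rightarrow> real \<Rightarrow> 'a::banach"
  assumes der: "\<And>k x. (f k has_vector_derivative f' k x) (at x)"
    and bd: "\<And>k x. norm (f' k x) \<le> b k" and b: "summable b"
    and sm: "\<And>x. summable (\<lambda>k. f k x)"
  shows "((\<lambda>x. \<Sum>k. f k x) has_vector_derivative (\<Sum>k. f' k x)) (at x)"
proof -
  have lim: "uniform_limit UNIV (\<lambda>n x. \<Sum>k<n. f' k x) (\<lambda>x. \<Sum>k. f' k x) sequentially"
    by (rule Weierstrass_m_test) (use bd b in auto)
  have "\<exists>g. \<forall>x\<in>UNIV. (\<lambda>n. f n x) sums (g x) \<and> (g has_derivative (\<lambda>h. h *\<^sub>R (\<Sum>k. f' k x))) (at x within UNIV)"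
  proof (rule has_derivative_series)
    fix e :: real assume "e > 0"
    then have "\<forall>\<^sub>F n in sequentially. \<forall>x\<in>UNIV. dist (\<Sum>k<n. f' k x) (\<Sum>k. f' k x) < e"
      using lim by (simp add: uniform_limit_iff)
    then show "\<forall>\<^sub>F n in sequentially. \<forall>x\<in>UNIV. \<forall>h.
        norm ((\<Sum>k<n. h *\<^sub>R f' k x) - h *\<^sub>R (\<Sum>k. f' k x)) \<le> e * norm h"
    proof eventually_elim
      case (elim n)
      have "norm (h *\<^sub>R ((\<Sum>k<n. f' k x) - (\<Sum>k. f' k x))) \<le> e * norm h" for x h
        using mult_right_mono[OF less_imp_le[OF elim[rule_format, of x]], of "\<bar>h\<bar>"]
        by (simp add: dist_norm mult.commute)
      then show ?case by (simp add: scaleR_sum_right scaleR_diff_right)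
    qed
  qed (use der sm[of 0, THEN summable_sums] in \<open>auto simp: has_vector_derivative_def\<close>)
  then obtain g where g: "\<And>x. (\<lambda>n. f n x) sums (g x)"
      "\<And>x. (g has_derivative (\<lambda>h. h *\<^sub>R (\<Sum>k. f' k x))) (at x)" by auto
  then have "g = (\<lambda>x. \<Sum>k. f k x)" by (auto simp: sums_unique)
  with g(2) show ?thesis by (simp add: has_vector_derivative_def)
qed

lemma has_vector_derivative_theta:
  assumes "M \<in> LC"
  shows "(theta M j has_vector_derivative theta M (Suc j) x) (at x)"
proof -
  have "((\<lambda>x. of_real c * \<i> ^ j * cis (q * x)) has_vector_derivative
      of_real (c * q) * \<i> ^ Suc j * cis (q * x)) (at x)" for c q x :: real
  proof -
    have "((\<lambda>x. cis (q * x)) has_vector_derivative q *\<^sub>R (\<i> * cis (q * x))) (at x)"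
      unfolding has_vector_derivative_def
      by (auto intro!: derivative_eq_intros simp: scaleR_conv_of_real)
    from has_vector_derivative_mult_right[OF this, of "of_real c * \<i> ^ j"] show ?thesis
      by (simp add: scaleR_conv_of_real mult_ac)
  qed
  note d = this[of "theta_coeff M _ * quot M _ ^ j" "quot M _", unfolded mult.assoc power_Suc2[symmetric]]
  show ?thesis
    unfolding theta_def[abs_def]
    apply (rule has_vector_derivative_suminf[where b = "\<lambda>k. theta_coeff M k * quot M k ^ Suc j"])
    subgoal using d by (simp add: mult_ac)
    subgoal by (simp only: norm_theta_term[OF assms] order_refl)
    subgoal using summable_theta_coeff[OF assms] .
    subgoal for x by (rule summable_norm_cancel) (simp only: norm_theta_term[OF assms] summable_theta_coeff[OF assms])
    done
qed

section \<open>Derivatives of the Gaussian\<close>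

text \<open>The \<open>n\<close>-th derivative of \<open>x \<mapsto> exp (- x\<^sup>2 / 2)\<close>, given by the three-term recurrence of the Hermite polynomials.\<close>
fun gauss_deriv :: "nat \<Rightarrow> real \<Rightarrow> real" where
  "gauss_deriv 0 x = exp (- x\<^sup>2 / 2)"
| "gauss_deriv (Suc 0) x = - x * exp (- x\<^sup>2 / 2)"
| "gauss_deriv (Suc (Suc n)) x = - (x * gauss_deriv (Suc n) x + real (Suc n) * gauss_deriv n x)"

lemma has_real_derivative_gauss_deriv: "(gauss_deriv n has_real_derivative gauss_deriv (Suc n) x) (at x)"
proof (induction n rule: induct_nat_012)
  case 0
  have "((\<lambda>x. exp (- x\<^sup>2 / 2)) has_real_derivative - x * exp (- x\<^sup>2 / 2)) (at x)"
    by (auto intro!: derivative_eq_intros)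
  then show ?case by simp
next
  case 1
  have "((\<lambda>x. - x * exp (- x\<^sup>2 / 2)) has_real_derivative
      - (x * (- x * exp (- x\<^sup>2 / 2)) + exp (- x\<^sup>2 / 2))) (at x)"
    by (auto intro!: derivative_eq_intros)
  then show ?case by simp
next
  case (ge2 n)
  have "((\<lambda>x. - (x * gauss_deriv (Suc n) x + real (Suc n) * gauss_deriv n x)) has_real_derivative
      - (x * gauss_deriv (Suc (Suc n)) x + 1 * gauss_deriv (Suc n) x + real (Suc n) * gauss_deriv (Suc n) x)) (at x)"
    using ge2 by (intro DERIV_minus DERIV_add DERIV_mult' DERIV_ident DERIV_cmult) auto
  then show ?case by (simp add: algebra_simps)
qed

text \<open>The recurrence trades a derivative for a power of \<open>x\<close>, so everything reduces to the case \<open>b = 0\<close>, which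
  follows from \<open>\<bar>x\<bar> ^ a \<le> a! * exp \<bar>x\<bar>\<close>. The resulting bound is far from sharp, but factorials are what
  a non-quasianalytic sequence dominates.\<close>
lemma gauss_deriv_bound: "\<bar>x ^ a * gauss_deriv b x\<bar> \<le> 2 * 2 ^ b * fact (a + b)"
proof -
  have base: "\<bar>x ^ a * gauss_deriv 0 x\<bar> \<le> 2 * fact a" for a
  proof -
    have "\<bar>x\<bar> ^ a / fact a = (\<Sum>n\<in>{a}. \<bar>x\<bar> ^ n / fact n)" by simp
    also have "\<dots> \<le> (\<Sum>n. \<bar>x\<bar> ^ n / fact n)"
      using summable_exp[of "\<bar>x\<bar>"] by (intro sum_le_suminf) (auto simp: field_simps)
    also have "\<dots> = exp \<bar>x\<bar>" by (simp add: exp_def scaleR_conv_of_real field_simps)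
    finally have 1: "\<bar>x\<bar> ^ a \<le> exp \<bar>x\<bar> * fact a" by (simp add: field_simps)
    have "\<bar>x ^ a * gauss_deriv 0 x\<bar> = \<bar>x\<bar> ^ a * exp (- x\<^sup>2 / 2)" by (simp add: abs_mult power_abs)
    also have "\<dots> \<le> (exp \<bar>x\<bar> * fact a) * exp (- x\<^sup>2 / 2)" using 1 by (intro mult_right_mono) auto
    also have "\<dots> = exp (\<bar>x\<bar> - x\<^sup>2 / 2) * fact a" by (simp flip: exp_add)
    also have "\<bar>x\<bar> - x\<^sup>2 / 2 \<le> 1 / 2"
      using zero_le_power2[of "\<bar>x\<bar> - 1"] by (simp add: power2_eq_square algebra_simps)
    then have "exp (\<bar>x\<bar> - x\<^sup>2 / 2) \<le> 2" using exp_half_le2 by (meson exp_le_cancel_iff order_trans)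
    then have "exp (\<bar>x\<bar> - x\<^sup>2 / 2) * fact a \<le> 2 * fact a" by (intro mult_right_mono) auto
    finally show ?thesis .
  qed
  show ?thesis
  proof (induction b arbitrary: a rule: induct_nat_012)
    case 0 show ?case using base[of a] by simp
  next
    case 1
    have "\<bar>x ^ a * gauss_deriv (Suc 0) x\<bar> = \<bar>x ^ Suc a * gauss_deriv 0 x\<bar>" by (simp add: abs_mult mult_ac)
    also have "\<dots> \<le> 2 * fact (Suc a)" by (rule base)
    also have "\<dots> \<le> 2 * 2 ^ Suc 0 * fact (a + Suc 0)" by simp
    finally show ?case .
  next
    case (ge2 n)
    have "\<bar>x ^ a * gauss_deriv (Suc (Suc n)) x\<bar> =
        \<bar>x ^ Suc a * gauss_deriv (Suc n) x + real (Suc n) * (x ^ a * gauss_deriv n x)\<bar>"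
      by (simp only: gauss_deriv.simps) (simp add: algebra_simps)
    also have "\<dots> \<le> \<bar>x ^ Suc a * gauss_deriv (Suc n) x\<bar> + real (Suc n) * \<bar>x ^ a * gauss_deriv n x\<bar>"
      by (rule order_trans[OF abs_triangle_ineq]) (simp add: abs_mult)
    also have "\<dots> \<le> 2 * 2 ^ Suc n * fact (Suc a + Suc n) + real (Suc n) * (2 * 2 ^ n * fact (a + n))"
      by (intro add_mono mult_left_mono ge2) auto
    also have "real (Suc n) * (2 * 2 ^ n * fact (a + n)) \<le> 2 * 2 ^ n * fact (Suc a + Suc n)"
    proof -
      have "real (Suc n) * fact (a + n) \<le> real (Suc (Suc (a + n))) * (real (Suc (a + n)) * fact (a + n))"
        by (intro mult_mono) (auto intro: order_trans[OF _ mult_right_mono[of 1]])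
      also have "\<dots> = fact (Suc a + Suc n)" by simp
      finally show ?thesis by simp
    qed
    also have "2 * 2 ^ Suc n * fact (Suc a + Suc n) + 2 * 2 ^ n * fact (Suc a + Suc n)
        = 6 * (2 ^ n * fact (Suc a + Suc n) :: real)" by simp
    also have "\<dots> \<le> 8 * (2 ^ n * fact (Suc a + Suc n))" by (intro mult_right_mono) auto
    also have "\<dots> = 2 * 2 ^ Suc (Suc n) * fact (a + Suc (Suc n))" by simp
    finally show ?case by simp
  qed
qed

text \<open>Equivalently, \<open>exp (y\<^sup>2 / 2)\<close>, the Gaussian on the imaginary axis, has non-negative Taylor coefficients.\<close>
lemma gauss_deriv_at_0: "\<exists>g\<ge>0. complex_of_real (gauss_deriv n 0) = of_real g * \<i> ^ n"
proof (induction n rule: induct_nat_012)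
  case 0 show ?case by (intro exI[of _ 1]) simp
next
  case 1 show ?case by (intro exI[of _ 0]) simp
next
  case (ge2 n)
  then obtain g where "g \<ge> 0" "complex_of_real (gauss_deriv n 0) = of_real g * \<i> ^ n" by blast
  then show ?case by (intro exI[of _ "real (Suc n) * g"]) (auto simp: algebra_simps)
qed

section \<open>Higher derivatives of a product\<close>

text \<open>\<open>leibniz u v n i j\<close> is the \<open>n\<close>-th derivative of \<open>u i * v j\<close>, where \<open>u\<close> and \<open>v\<close> list the successive derivatives
  of two functions. Applying the product rule once in each step, instead of writing the sum with
  binomial coefficients, makes the estimates below plain inductions.\<close>
primrec leibniz :: "(nat \<Rightarrow> real \<Rightarrow> complex) \<Rightarrow> (nat \<Rightarrow> real \<Rightarrow> complex) \<Rightarrow> nat \<Rightarrow> nat \<Rightarrow> nat \<Rightarrow> real \<Rightarrow> complex"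
where
  "leibniz u v 0 i j x = u i x * v j x"
| "leibniz u v (Suc n) i j x = leibniz u v n (Suc i) j x + leibniz u v n i (Suc j) x"

lemma has_vector_derivative_leibniz:
  assumes "\<And>i x. (u i has_vector_derivative u (Suc i) x) (at x)"
    and "\<And>j x. (v j has_vector_derivative v (Suc j) x) (at x)"
  shows "(leibniz u v n i j has_vector_derivative leibniz u v (Suc n) i j x) (at x)"
proof (induction n arbitrary: i j)
  case 0
  have "((\<lambda>x. u i x * v j x) has_vector_derivative u i x * v (Suc j) x + u (Suc i) x * v j x) (at x)"
    by (intro has_vector_derivative_mult assms)
  then show ?case by (simp add: leibniz.simps(1)[abs_def] add.commute)
next
  case (Suc n)
  have "((\<lambda>x. leibniz u v n (Suc i) j x + leibniz u v n i (Suc j) x) has_vector_derivative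
     leibniz u v (Suc n) (Suc i) j x + leibniz u v (Suc n) i (Suc j) x) (at x)"
    by (intro has_vector_derivative_add Suc)
  then show ?case by (simp add: leibniz.simps(2)[abs_def])
qed

lemma norm_leibniz_le:
  assumes "\<And>i j. norm (c * (u i x * v j x)) \<le> B (i + j)"
  shows "norm (c * leibniz u v n i j x) \<le> 2 ^ n * B (n + i + j)"
proof (induction n arbitrary: i j)
  case (Suc n)
  have "norm (c * leibniz u v (Suc n) i j x) \<le>
      norm (c * leibniz u v n (Suc i) j x) + norm (c * leibniz u v n i (Suc j) x)"
    by (simp add: distrib_left norm_triangle_ineq)
  with Suc[of "Suc i" j] Suc[of i "Suc j"] show ?case by simp
qed (use assms in simp)

text \<open>When the derivatives of both factors have the phase \<open>\<i> ^ n\<close> at a point, so has every term of the Leibniz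
  formula. The derivative of the product is then at least as large as any single term, in
  particular the one in which all derivatives fall on the first factor.\<close>
lemma leibniz_same_phase:
  assumes u: "\<And>i. p i \<ge> 0" "\<And>i. u i x = of_real (p i) * \<i> ^ i"
    and v: "\<And>j. q j \<ge> 0" "\<And>j. v j x = of_real (q j) * \<i> ^ j"
  shows "\<exists>r \<ge> p (n + i) * q j. leibniz u v n i j x = of_real r * \<i> ^ (n + i + j)"
proof (induction n arbitrary: i j)
  case 0
  show ?case by (intro exI[of _ "p i * q j"]) (simp add: u v power_add)
next
  case (Suc n)
  obtain r s where rs: "r \<ge> p (n + Suc i) * q j" "s \<ge> p (n + i) * q (Suc j)"
    "leibniz u v n (Suc i) j x = of_real r * \<i> ^ (n + Suc i + j)"
    "leibniz u v n i (Suc j) x = of_real s * \<i> ^ (n + i + Suc j)"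
    using Suc[of "Suc i" j] Suc[of i "Suc j"] by auto
  have "p (n + i) * q (Suc j) \<ge> 0" using u v by simp
  with rs show ?case by (intro exI[of _ "r + s"]) (auto simp: algebra_simps)
qed

section \<open>Gelfand--Shilov classes in one dimension\<close>

lemma partials_real1:
  fixes F :: "nat \<Rightarrow> real \<Rightarrow> complex"
  assumes F: "\<And>n x. (F n has_vector_derivative F (Suc n) x) (at x)"
  shows "smooth (\<lambda>x :: real ^ 1. F 0 (x $ 1))"
    and "mi_partial \<beta> (\<lambda>x :: real ^ 1. F 0 (x $ 1)) = (\<lambda>x. F (\<beta> $ 1) (x $ 1))"
proof -
  have d: "((\<lambda>t. F n ((x + t *\<^sub>R axis i 1) $ 1)) has_vector_derivative F (Suc n) (x $ 1)) (at 0)"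
    for n i and x :: "real ^ 1"
  proof -
    have "((\<lambda>t. x $ 1 + t) has_vector_derivative 1) (at 0)"
      by (auto intro!: derivative_eq_intros)
    from vector_diff_chain_at[OF this, of "F n"] F[of n "x $ 1"] show ?thesis
      by (simp add: o_def axis_def)
  qed
  have p: "partials is (\<lambda>x :: real ^ 1. F 0 (x $ 1)) = (\<lambda>x. F (length is) (x $ 1))" for "is"
  proof (induction "is")
    case (Cons i "is")
    show ?case
      using Cons by (simp only: partials_def foldr_Cons o_apply partial_def vector_derivative_at[OF d]
          list.size add_0_right add_Suc_right)
  qed (simp add: partials_def)
  have "continuous_on UNIV (F n)" for n
    using F by (meson continuous_at_imp_continuous_on has_vector_derivative_continuous)
  then have "continuous_on UNIV (\<lambda>x :: real ^ 1. F n (x $ 1))" for n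
    by (rule continuous_on_compose2) (auto intro!: continuous_intros)
  then show "smooth (\<lambda>x :: real ^ 1. F 0 (x $ 1))"
    unfolding smooth_def p has_partial_def using d by (blast intro: differentiableI_vector)
  have "count_list is (1 :: 1) = length is" for "is"
    by (induction "is") auto
  then show "mi_partial \<beta> (\<lambda>x :: real ^ 1. F 0 (x $ 1)) = (\<lambda>x. F (\<beta> $ 1) (x $ 1))"
    unfolding mi_partial_def p by (metis count_list_mi_partial)
qed

text \<open>For log-convex \<open>M\<close> one has \<open>M a * M b \<le> M (a + b)\<close>, so the bound for separated growth also yields the
  one for joint growth.\<close>
lemma gs_class_real1_I:
  fixes F :: "nat \<Rightarrow> real \<Rightarrow> complex"
  assumes F: "\<And>n x. (F n has_vector_derivative F (Suc n) x) (at x)"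
    and M: "M \<in> LC" and h: "h > 0"
    and bd: "\<And>a b x. norm (of_real x ^ a * F b x) \<le> C * h ^ (a + b) * (M a * M b)"
  shows "(\<lambda>x :: real ^ 1. F 0 (x $ 1)) \<in> gs_class s M"
proof -
  let ?f = "\<lambda>x :: real ^ 1. F 0 (x $ 1)"
  have C: "C \<ge> 0" using bd[of 0 0 0] LC_0[OF M] by (simp add: order_trans[OF norm_ge_zero])
  have w: "M (mi_abs \<alpha>) * M (mi_abs \<beta>) \<le> gs_weight s M \<alpha> \<beta>" "gs_weight s M \<alpha> \<beta> > 0"
    for \<alpha> \<beta> :: "nat ^ 1"
    using LC_mult_le[OF M] LC_pos[OF M] by (cases s; simp add: mi_abs_def)+
  have "gs_norm s M h ?f \<le> ennreal C"
    unfolding gs_norm_def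
  proof (rule SUP_least, clarify)
    fix \<alpha> \<beta> :: "nat ^ 1"
    let ?w = "h ^ mi_abs (\<alpha> + \<beta>) * gs_weight s M \<alpha> \<beta>"
    have pos: "?w > 0" using h w(2) by simp
    have "sup_norm (\<lambda>x. complex_of_real (mi_monom \<alpha> x) * mi_partial \<beta> ?f x) \<le> ennreal (C * ?w)"
      unfolding sup_norm_def partials_real1(2)[where F = F, OF F]
    proof (intro SUP_least ennreal_leI)
      fix x :: "real ^ 1"
      have "norm (complex_of_real (mi_monom \<alpha> x) * F (\<beta> $ 1) (x $ 1)) \<le> C * h ^ mi_abs (\<alpha> + \<beta>) * (M (mi_abs \<alpha>) * M (mi_abs \<beta>))"
        using bd[of "x $ 1" "\<alpha> $ 1" "\<beta> $ 1"] by (simp add: mi_monom_def mi_abs_def)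
      also have "\<dots> \<le> C * h ^ mi_abs (\<alpha> + \<beta>) * gs_weight s M \<alpha> \<beta>"
        using C h w(1) by (intro mult_left_mono) auto
      finally show "norm (complex_of_real (mi_monom \<alpha> x) * F (\<beta> $ 1) (x $ 1)) \<le> C * ?w"
        by (simp add: mult_ac)
    qed
    then have "sup_norm (\<lambda>x. complex_of_real (mi_monom \<alpha> x) * mi_partial \<beta> ?f x) / ennreal ?w
        \<le> ennreal (C * ?w) / ennreal ?w"
      by (rule divide_right_mono_ennreal)
    also have "\<dots> = ennreal (C * ?w / ?w)"
      by (rule divide_ennreal) (use C pos in \<open>simp_all only: mult_nonneg_nonneg less_imp_le\<close>)
    also have "C * ?w / ?w = C"
      by (rule nonzero_mult_div_cancel_right[OF less_imp_neq[OF pos, symmetric]])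
    finally show "sup_norm (\<lambda>x. complex_of_real (mi_monom \<alpha> x) * mi_partial \<beta> ?f x) / ennreal ?w \<le> ennreal C" .
  qed
  then have "gs_norm s M h ?f < \<infinity>" by (rule le_less_trans) simp
  then show ?thesis
    using h partials_real1(1)[where F = F, OF F] by (auto simp: gs_class_def)
qed

text \<open>Only \<open>\<alpha> = 0\<close> is looked at; there the two weights agree since \<open>N 0 = 1\<close>.\<close>
lemma gs_class_real1_D:
  fixes F :: "nat \<Rightarrow> real \<Rightarrow> complex"
  assumes F: "\<And>n x. (F n has_vector_derivative F (Suc n) x) (at x)"
    and N: "\<And>p. N p > 0" "N 0 = 1"
    and mem: "(\<lambda>x :: real ^ 1. F 0 (x $ 1)) \<in> gs_class s N"
  shows "\<exists>C\<ge>0. \<exists>h>0. \<forall>b x. norm (F b x) \<le> C * h ^ b * N b"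
proof -
  let ?f = "\<lambda>x :: real ^ 1. F 0 (x $ 1)"
  from mem obtain h where h: "h > 0" "gs_norm s N h ?f < \<infinity>" by (auto simp: gs_class_def)
  then obtain C where C: "C \<ge> 0" "gs_norm s N h ?f = ennreal C"
    by (auto simp: less_top_ennreal infinity_ennreal_def)
  have "norm (F b x) \<le> C * h ^ b * N b" for b x
  proof -
    let ?\<alpha> = "0 :: nat ^ 1" and ?\<beta> = "(\<chi> i. b) :: nat ^ 1"
    have w: "h ^ mi_abs (?\<alpha> + ?\<beta>) * gs_weight s N ?\<alpha> ?\<beta> = h ^ b * N b"
      using N by (cases s) (simp_all add: mi_abs_def)
    have pos: "h ^ b * N b > 0" using h N by simp
    have "ennreal (norm (F b x)) \<le> sup_norm (\<lambda>x. complex_of_real (mi_monom ?\<alpha> x) * mi_partial ?\<beta> ?f x)"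
      unfolding sup_norm_def partials_real1(2)[where F = F, OF F]
      by (rule SUP_upper2[of "\<chi> i. x"]) (auto simp: mi_monom_def)
    then have "ennreal (norm (F b x)) / ennreal (h ^ b * N b) \<le>
        sup_norm (\<lambda>x. complex_of_real (mi_monom ?\<alpha> x) * mi_partial ?\<beta> ?f x) / ennreal (h ^ b * N b)"
      by (rule divide_right_mono_ennreal)
    also have "\<dots> \<le> gs_norm s N h ?f"
      unfolding gs_norm_def 
      by (rule SUP_upper2[of "(?\<alpha>, ?\<beta>)"]) (simp_all only: w UNIV_I case_prod_conv order_refl)
    finally have "norm (F b x) / (h ^ b * N b) \<le> C"
      using pos C by (simp add: divide_ennreal)
    then show ?thesis using pos by (simp add: divide_le_eq mult_ac)
  qed
  with C h show ?thesis by blast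
qed

text \<open>The test function is the characteristic function of \<open>M\<close> times the Gaussian. The bounds of both
  factors put it into the class of \<open>M\<close>, and the common phase of their derivatives at the origin keeps the
  derivatives of the product as large as \<open>M\<close>, up to a geometric factor. Membership in the class of \<open>N\<close> then bounds \<open>M\<close> by \<open>N\<close>.\<close>
lemma gs_inclusion_imp_preceq:
  assumes M: "M \<in> LC" and nq: "non_quasianalytic M"
    and N: "\<And>p. N p > 0" "N 0 = 1"
    and sub: "(gs_class s M :: (real ^ 1 \<Rightarrow> complex) set) \<subseteq> gs_class s N"
  shows "M \<preceq> N"
proof -
  define F where "F n = leibniz (theta M) (\<lambda>j x. of_real (gauss_deriv j x)) n 0 0" for n
  have der: "(F n has_vector_derivative F (Suc n) x) (at x)" for n x
    unfolding F_def
    by (intro has_vector_derivative_leibniz has_vector_derivative_theta M has_vector_derivative_of_real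
        has_real_derivative_gauss_deriv)
  obtain S where S: "S > 0" "\<And>n. fact n \<le> S ^ n * M n"
    using fact_le_non_quasianalytic[OF M nq] by blast
  define K where "K = max 1 (4 * S)"
  have K: "K \<ge> 1" "4 * S \<le> K" "2 * S \<le> 2 * K" using S by (auto simp: K_def)
  note pos = less_imp_le[OF LC_pos[OF M]]
  \<comment> \<open>\<open>4 * S\<close> collects \<open>2 ^ j\<close> from the Gaussian bound, \<open>2 ^ j\<close> from splitting \<open>fact (a + j)\<close> into
    \<open>fact a * fact j\<close>, and \<open>S ^ j\<close> from comparing \<open>fact j\<close> with \<open>M j\<close>; the powers of \<open>K\<close> that remain are
    indexed by \<open>i + j\<close>, as the estimate of the Leibniz sum demands.\<close>
  have bd: "norm (of_real x ^ a * F b x) \<le> 4 * (2 * K) ^ (a + b) * (M a * M b)" for a b x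
  proof -
    have 1: "norm (of_real x ^ a * (theta M i x * of_real (gauss_deriv j x))) \<le>
        4 * (2 * K) ^ a * M a * (K ^ (i + j) * M (i + j))" for i j
    proof -
      have "fact (a + j) = real ((a + j) choose a) * (fact a * fact j)"
        by (simp add: binomial_fact)
      also have "\<dots> \<le> 2 ^ (a + j) * ((S ^ a * M a) * (S ^ j * M j))"
      proof (intro mult_mono S)
        have "real ((a + j) choose a) \<le> real (2 ^ (a + j))"
          by (intro of_nat_mono binomial_le_pow2)
        then show "real ((a + j) choose a) \<le> 2 ^ (a + j)" by simp
      qed (use S pos in auto)
      finally have f: "fact (a + j) \<le> 2 ^ (a + j) * ((S ^ a * M a) * (S ^ j * M j))" .
      have "norm (of_real x ^ a * (theta M i x * of_real (gauss_deriv j x))) = norm (theta M i x) * \<bar>x ^ a * gauss_deriv j x\<bar>"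
        by (simp add: norm_mult norm_power abs_mult power_abs)
      also have "\<dots> \<le> (2 * M i) * (2 * 2 ^ j * fact (a + j))"
        using pos by (intro mult_mono norm_theta_le M gauss_deriv_bound) auto
      also have "\<dots> \<le> (2 * M i) * (2 * 2 ^ j * (2 ^ (a + j) * ((S ^ a * M a) * (S ^ j * M j))))"
        using pos f by (intro mult_left_mono) auto
      also have "\<dots> = 4 * (2 * S) ^ a * M a * ((4 * S) ^ j * (M i * M j))"
      proof -
        have "(4::real) ^ j = 2 ^ j * 2 ^ j" by (simp flip: power_mult_distrib)
        then show ?thesis by (simp add: power_add power_mult_distrib mult_ac)
      qed
      also have "\<dots> \<le> 4 * (2 * K) ^ a * M a * (K ^ (i + j) * M (i + j))"
      proof -
        have "(4 * S) ^ j \<le> K ^ j" using S K by (intro power_mono) auto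
        also have "\<dots> \<le> K ^ (i + j)" using K by (intro power_increasing) auto
        finally have "(4 * S) ^ j \<le> K ^ (i + j)" .
        moreover have "(2 * S) ^ a \<le> (2 * K) ^ a" using S K by (intro power_mono) auto
        ultimately show ?thesis
          using pos S K LC_mult_le[OF M] by (intro mult_mono) (auto intro!: mult_nonneg_nonneg)
      qed
      finally show ?thesis .
    qed
    have "norm (of_real x ^ a * F b x) \<le> 2 ^ b * (4 * (2 * K) ^ a * M a * (K ^ (b + 0 + 0) * M (b + 0 + 0)))"
      unfolding F_def by (rule norm_leibniz_le) (rule 1)
    also have "\<dots> = 4 * (2 * K) ^ (a + b) * (M a * M b)"
      by (simp add: power_add power_mult_distrib mult_ac)
    finally show ?thesis .
  qed
  have "(\<lambda>x :: real ^ 1. F 0 (x $ 1)) \<in> gs_class s M"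
    by (rule gs_class_real1_I[where F = F, OF der M _ bd]) (use K in simp)
  with sub obtain C h where C: "C \<ge> 0" "h > 0" "\<And>b x. norm (F b x) \<le> C * h ^ b * N b"
    using gs_class_real1_D[where F = F and N = N, OF der N] by blast
  define g where "g j = (SOME g. g \<ge> 0 \<and> complex_of_real (gauss_deriv j 0) = of_real g * \<i> ^ j)" for j
  have g: "g j \<ge> 0" "complex_of_real (gauss_deriv j 0) = of_real (g j) * \<i> ^ j" for j
    using someI_ex[OF gauss_deriv_at_0[of j]] unfolding g_def by auto
  have g0: "g 0 = 1" using g(2)[of 0] by simp
  define s where "s j = (\<Sum>k. theta_coeff M k * quot M k ^ j)" for j
  have s: "M j * (1/2) ^ j \<le> s j" "theta M j 0 = of_real (s j) * \<i> ^ j" for j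
    using theta_at_0[OF M, of j] by (simp_all add: s_def)
  have s0: "s j \<ge> 0" for j using s(1)[of j] pos[of j] by (smt (verit) zero_le_power mult_nonneg_nonneg divide_nonneg_nonneg)
  have low: "M n * (1/2) ^ n \<le> norm (F n 0)" for n
  proof -
    obtain r where r: "r \<ge> s (n + 0) * g 0" "F n 0 = of_real r * \<i> ^ (n + 0 + 0)"
      unfolding F_def using leibniz_same_phase[of s "theta M" 0 g "\<lambda>j x. of_real (gauss_deriv j x)" n 0 0] s0 s g by blast
    then have "norm (F n 0) = \<bar>r\<bar>" by (simp add: norm_mult norm_power)
    with r s(1)[of n] g0 show ?thesis by simp
  qed
  \<comment> \<open>The constant \<open>C\<close> in front is at most \<open>max 1 C ^ p\<close> for \<open>p \<ge> 1\<close>; for \<open>p = 0\<close> the normalisation of \<open>M\<close>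
    and \<open>N\<close> is used.\<close>
  define D where "D = max 1 (2 * h * max 1 C)"
  have "M p \<le> D ^ p * N p" for p
  proof (cases p)
    case 0
    then show ?thesis using N LC_0[OF M] by simp
  next
    case (Suc q)
    have "C \<le> max 1 C ^ p"
      using self_le_power[of "max 1 C" p] Suc by simp
    have "M p = 2 ^ p * (M p * (1/2) ^ p)" by (simp add: power_divide)
    also have "\<dots> \<le> 2 ^ p * (C * h ^ p * N p)"
      using low[of p] C(3)[of p 0] by (intro mult_left_mono) auto
    also have "\<dots> = C * (2 * h) ^ p * N p" by (simp add: power_mult_distrib mult_ac)
    also have "\<dots> \<le> max 1 C ^ p * (2 * h) ^ p * N p"
      using \<open>C \<le> max 1 C ^ p\<close> C N(1)[of p] by (intro mult_right_mono) auto
    also have "\<dots> = (2 * h * max 1 C) ^ p * N p" by (simp add: power_mult_distrib mult_ac)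
    also have "\<dots> \<le> D ^ p * N p"
      using N(1)[of p] C by (intro mult_right_mono power_mono) (auto simp: D_def)
    finally show ?thesis .
  qed
  then show ?thesis unfolding preceq_def by (intro exI[of _ D]) (auto simp: D_def)
qed

theorem theorem6p1:
  fixes M N :: "nat \<Rightarrow> real"
  assumes "\<And>p. M p > 0" and "\<And>p. N p > 0" and "M 0 = 1" and "N 0 = 1"
  shows "(M \<preceq> N \<longrightarrow> (\<forall>s. gs_continuously_included TYPE('n::finite) s M N)) \<and>
         (M \<in> LC \<and> non_quasianalytic M \<longrightarrow>
            (\<forall>s. gs_continuously_included TYPE(1) s M N \<longrightarrow> M \<preceq> N))"
proof (intro conjI impI allI)
  fix s assume "M \<preceq> N"
  then show "gs_continuously_included TYPE('n) s M N"
    using assms by (intro preceq_imp_gs_continuously_included)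
next
  fix s assume "M \<in> LC \<and> non_quasianalytic M" and "gs_continuously_included TYPE(1) s M N"
  then show "M \<preceq> N"
    using gs_inclusion_imp_preceq[of M N s] assms by (auto simp: gs_continuously_included_def)
qed

end
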